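(* Let $X$ be any splitting configuration of $X^\natural=Gr(2,5)[3,1,1]$, with associated matrices $L_1,T_{\mathcal O_X},T_{\mathcal S_X},T_N$ as in the context. Then the following matrix identities (coming from the fundamental group of the link $\mathfrak L^{(2)}_{3,3}$) hold: $$(T_{\mathcal S_X}T_{\mathcal O_X}L_1)^3\,a=a\,(T_{\mathcal S_X}T_{\mathcal O_X}L_1)^3,\qquad a\in\{L_1,T_{\mathcal O_X},T_{\mathcal S_X}\}.$$ Moreover, $$M_0\cdot L_1^3=(T_{\mathcal S_X}T_{\mathcal O_X}L_1)^3=T_N,$$ where $M_0=T_N\cdot L_1^{-3}$ is the window monodromy matrix of $X$ and $N=\int_{Y}\big(c_2(\mathcal N)^2-c_1(\mathcal N)c_3(\mathcal N)\big)$.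
   Context: **Splitting configuration.** Let $Y=Gr(2,5)[1,1]$ be a smooth intersection of $Gr(2,5)$ (Plücker embedding) with two generic hyperplanes, $\mathcal S$ the restriction of the rank-2 tautological bundle, $H=c_1(\mathcal S^\vee)$. Let $\mathcal N$ be a direct sum of (restrictions to $Y$ of) homogeneous bundles of the form $\mathcal O(p)\otimes\mathrm{Sym}^q\mathcal S^\vee$ ($p,q\ge0$, $(p,q)\ne(0,0)$, $\mathcal O(1)=\det\mathcal S^\vee$) with $c_1(\mathcal N)=3H$ and rank $n+1\ge2$. The splitting configuration $X\subset\mathbb P^n\times Y$ is the Calabi–Yau threefold cut out by a generic section of $\mathcal O_{\mathbb P^n}(1)\boxtimes\mathcal N$. $\mathcal S_X$ is the pullback of $\mathcal S$ to $X$. **Topological numbers.** Let $H_0=L$ be the hyperplane class of $\mathbb P^n$ and $H_1=H$. For $\alpha,\beta,\gamma\in\{0,1\}$, $c_{\alpha\beta\gamma}=\int_XH_\alpha H_\beta H_\gamma$ (so $c_{111}=15$, $c_{011}=\int_Yc_2(\mathcal N)H^2$, $c_{001}=\int_Yc_3(\mathcal N)H$, $c_{000}=\int_Yc_4(\mathcal N)$), $c_0=\frac1{24}\int_Xc_2(X)L$, $l=\frac16c_{000}+2c_0$, $b=\frac12(c_{011}-c_{001})$, $g=\int_Yc_2(\mathcal N)c_2(\mathcal S^\vee)$. **Matrices.** $6\times6$ matrices in the ordered basis $(\mathcal O_X,D_0,D_1,\widetilde C_0,\widetilde C_1,P)$, where columns are images of basis vectors: $$L_1=\begin{pmatrix}1&0&0&0&0&0\\0&1&0&0&0&0\\1&0&1&0&0&0\\c_{011}&c_{001}&c_{011}&1&0&0\\15&c_{011}&15&0&1&0\\0&b&0&0&1&1\end{pmatrix}$$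 (the twist by $\det^{-1}\mathcal S_X$). The Euler pairing $\chi(u,v)=u^t\chi v$ has matrix $$\chi=\begin{pmatrix}0&l&8&0&0&1\\-l&0&b&-1&0&0\\-8&-b&0&0&-1&0\\0&1&0&0&0&0\\0&0&1&0&0&0\\-1&0&0&0&0&0\end{pmatrix}.$$ For a class $e$, the spherical twist matrix is $T_e:v\mapsto v-\chi(e,v)\,e$. $T_{\mathcal O_X}=T_e$ with $e=(1,0,0,0,0,0)^t$, and $T_{\mathcal S_X}=T_e$ with $e=(2,0,-1,-g,-6,3)^t$, the class of $\mathcal S_X$. $T_N$ is the identity matrix plus the single entry $-N$ in row $\widetilde C_0$, column $D_0$. *)

theory Defs
  imports "HOL-Analysis.Analysis" "HOL-Computational_Algebra.Formal_Power_Series"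
    "HOL-Computational_Algebra.Polynomial"
begin

section \<open>Chern roots\<close>

text \<open>
  Bundles are represented by the lists of their Chern roots (splitting principle). The total
  Chern class is a power series whose coefficient at \<open>k\<close> is the \<open>k\<close>-th Chern class.
\<close>

definition chern :: "'a::comm_ring_1 list \<Rightarrow> 'a fps" where
  "chern E = (\<Prod>r\<leftarrow>E. 1 + fps_const r * fps_X)"

abbreviation chern_class :: "nat \<Rightarrow> 'a::comm_ring_1 list \<Rightarrow> 'a" where
  "chern_class k E \<equiv> fps_nth (chern E) k"

text \<open>Total Chern class of the virtual bundle \<open>E - F\<close>.\<close>

definition chern_diff :: "'a::comm_ring_1 list \<Rightarrow> 'a list \<Rightarrow> 'a fps" where
  "chern_diff E F = chern E * fps_left_inverse (chern F) 1"


section \<open>Intersection theory on \<open>Gr(2,5)\<close> and on \<open>Y\<close>\<close>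

text \<open>
  Classes are represented by polynomials in the Chern roots \<open>x\<^sub>1\<close>, \<open>x\<^sub>2\<close> of the dual \<open>S\<^sup>\<or>\<close> of the
  tautological bundle; the variable \<open>x\<^sub>1\<close> is the inner one.
  The rational cohomology ring of \<open>Gr(2,5)\<close> is the ring of symmetric polynomials
  modulo the ideal \<open>(h\<^sub>4, h\<^sub>5)\<close> of complete homogeneous ones.
\<close>

type_synonym gr_ring = "rat poly poly"

definition x1 :: gr_ring where "x1 = [:[:0, 1:]:]"

definition x2 :: gr_ring where "x2 = [:0, 1:]"

definition Sdual :: "gr_ring list" where "Sdual = [x1, x2]"

definition H :: gr_ring where "H = chern_class 1 Sdual"

text \<open>
  Integration reads off the coefficient of the Schur polynomial \<open>s\<^sub>3\<^sub>3 = (x\<^sub>1 x\<^sub>2)\<^sup>3\<close>, the class of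
  a point. As \<open>s\<^sub>a\<^sub>b (x\<^sub>1 - x\<^sub>2) = x\<^sub>1\<^bsup>a+1\<^esup> x\<^sub>2\<^bsup>b\<^esup> - x\<^sub>2\<^bsup>a+1\<^esup> x\<^sub>1\<^bsup>b\<^esup>\<close> for \<open>a \<ge> b\<close>, this is the coefficient of
  \<open>x\<^sub>1\<^sup>4 x\<^sub>2\<^sup>3\<close> after multiplication by \<open>x\<^sub>1 - x\<^sub>2\<close>.
\<close>

definition int_Gr :: "gr_ring \<Rightarrow> rat" where
  "int_Gr f = coeff (coeff (f * (x1 - x2)) 3) 4"

text \<open>\<open>Y\<close> is the intersection of two hyperplane sections, hence has class \<open>H\<^sup>2\<close>.\<close>

definition int_Y :: "gr_ring \<Rightarrow> rat" where
  "int_Y f = int_Gr (f * H ^ 2)"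

text \<open>
  The next three facts characterise integration: it is well defined modulo \<open>(h\<^sub>4, h\<^sub>5)\<close> and is
  normalised by the class of a point.
\<close>

lemma coeff_mult_x2_power: "coeff (f * x2 ^ k) m = (if m < k then 0 else coeff f (m - k))"
proof -
  have "x2 ^ k = monom 1 k"
    by (simp add: x2_def monom_altdef)
  then show ?thesis
    by (simp add: coeff_monom_mult mult.commute[of f])
qed

lemma coeff_mult_x1_power:
  "coeff (coeff (f * x1 ^ k) m) j = (if j < k then 0 else coeff (coeff f m) (j - k))"
proof -
  have "x1 ^ k = [:monom 1 k:]"
    by (simp add: x1_def monom_altdef poly_const_pow)
  then show ?thesis
    by (simp add: coeff_monom_mult mult.commute[of f])
qed

lemma int_Gr_relation:
  assumes "k = 4 \<or> k = 5"
  shows "int_Gr (f * (\<Sum>i\<le>k. x1 ^ i * x2 ^ (k - i))) = 0"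
proof -
  have "x1 ^ Suc k - x2 ^ Suc k = (x1 - x2) * (\<Sum>i\<le>k. x1 ^ i * x2 ^ (k - i))"
    using diff_power_eq_sum[of x1 k x2] by (simp only: lessThan_Suc_atMost)
  then have "f * (\<Sum>i\<le>k. x1 ^ i * x2 ^ (k - i)) * (x1 - x2) = f * x1 ^ Suc k - f * x2 ^ Suc k"
    by (simp only: right_diff_distrib[symmetric] mult_ac)
  with assms show ?thesis
    unfolding int_Gr_def
    by (simp only: coeff_diff coeff_mult_x1_power coeff_mult_x2_power) auto
qed

lemma int_Gr_point: "int_Gr ((x1 * x2) ^ 3) = 1"
proof -
  have "(x1 * x2) ^ 3 * (x1 - x2) = (1 * x2 ^ 3) * x1 ^ 4 - (1 * x1 ^ 3) * x2 ^ 4"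
    by algebra
  then show ?thesis
    unfolding int_Gr_def
    by (simp only: coeff_diff coeff_mult_x1_power coeff_mult_x2_power) simp
qed


section \<open>Splitting configurations\<close>

text \<open>
  The pair \<open>(p, q)\<close> stands for the summand \<open>\<O>(p) \<otimes> Sym\<^sup>q S\<^sup>\<or>\<close>, and a list of pairs for the direct
  sum of its summands.
\<close>

type_synonym vbundle = "(nat \<times> nat) list"

definition summand_roots :: "nat \<times> nat \<Rightarrow> gr_ring list" where
  "summand_roots = (\<lambda>(p, q).
     map (\<lambda>i. of_nat p * H + of_nat i * x1 + of_nat (q - i) * x2) [0..<Suc q])"

definition roots :: "vbundle \<Rightarrow> gr_ring list" where
  "roots N = concat (map summand_roots N)"

abbreviation bundle_rank :: "vbundle \<Rightarrow> nat" where
  "bundle_rank N \<equiv> length (roots N)"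

text \<open>
  The equation between first Chern classes may be tested on polynomials, as \<open>Gr(2,5)\<close> has no
  relation in degree one and restricts isomorphically to \<open>Y\<close> there.
\<close>

definition splitting_configuration :: "nat \<Rightarrow> vbundle \<Rightarrow> bool" where
  "splitting_configuration n N \<longleftrightarrow>
     (0, 0) \<notin> set N \<and> chern_class 1 (roots N) = 3 * H \<and> bundle_rank N = n + 1 \<and> n + 1 \<ge> 2"

text \<open>
  Classes on \<open>\<P>\<^sup>n \<times> Gr(2,5)\<close> are polynomials in the hyperplane class \<open>L\<close> of \<open>\<P>\<^sup>n\<close>, whose
  coefficients are classes on \<open>Gr(2,5)\<close>.
\<close>

type_synonym prod_ring = "gr_ring poly"

definition L :: prod_ring where "L = [:0, 1:]"

definition pull :: "gr_ring \<Rightarrow> prod_ring" where "pull f = [:f:]"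

definition twisted_roots :: "vbundle \<Rightarrow> prod_ring list" where
  "twisted_roots N = map (\<lambda>r. L + pull r) (roots N)"

text \<open>
  \<open>X\<close> is the zero locus in \<open>\<P>\<^sup>n \<times> Y\<close> of a section of \<open>\<O>(1) \<boxtimes> N\<close>, so its class is the top Chern
  class of that bundle; integrating over \<open>\<P>\<^sup>n\<close> extracts the coefficient of \<open>L\<^sup>n\<close>.
\<close>

definition int_X :: "nat \<Rightarrow> vbundle \<Rightarrow> prod_ring \<Rightarrow> rat" where
  "int_X n N f = int_Y (coeff (f * chern_class (bundle_rank N) (twisted_roots N)) n)"

text \<open>
  The tangent bundle of \<open>X\<close> is, as a virtual bundle, the restriction of
  \<open>T\<^bsub>\<P>\<^sup>n\<^esub> + T\<^bsub>Gr(2,5)\<^esub> - 2 \<O>(H) - \<O>(1) \<boxtimes> N\<close>. By the Euler sequences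
  \<open>T\<^bsub>\<P>\<^sup>n\<^esub> = (n+1) \<O>(L) - \<O>\<close> and \<open>T\<^bsub>Gr(2,5)\<^esub> = 5 S\<^sup>\<or> - S \<otimes> S\<^sup>\<or>\<close>; trivial summands are omitted.
\<close>

definition chern_X :: "nat \<Rightarrow> vbundle \<Rightarrow> prod_ring fps" where
  "chern_X n N = chern_diff
     (replicate (n + 1) L @ replicate 5 (pull x1) @ replicate 5 (pull x2))
     ([pull (x1 - x2), pull (x2 - x1)] @ [pull H, pull H] @ twisted_roots N)"


section \<open>Topological numbers\<close>

definition divisor :: "nat \<Rightarrow> prod_ring" where
  "divisor \<alpha> = (if \<alpha> = 0 then L else pull H)"

definition triple :: "nat \<Rightarrow> vbundle \<Rightarrow> nat \<Rightarrow> nat \<Rightarrow> nat \<Rightarrow> rat" where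
  "triple n N \<alpha> \<beta> \<gamma> = int_X n N (divisor \<alpha> * divisor \<beta> * divisor \<gamma>)"

definition c0 :: "nat \<Rightarrow> vbundle \<Rightarrow> rat" where
  "c0 n N = 1 / 24 * int_X n N (fps_nth (chern_X n N) 2 * L)"

definition l_number :: "nat \<Rightarrow> vbundle \<Rightarrow> rat" where
  "l_number n N = 1 / 6 * triple n N 0 0 0 + 2 * c0 n N"

definition b_number :: "nat \<Rightarrow> vbundle \<Rightarrow> rat" where
  "b_number n N = 1 / 2 * (triple n N 0 1 1 - triple n N 0 0 1)"

definition g_number :: "vbundle \<Rightarrow> rat" where
  "g_number N = int_Y (chern_class 2 (roots N) * chern_class 2 Sdual)"

definition N_number :: "vbundle \<Rightarrow> rat" where
  "N_number N = int_Y (chern_class 2 (roots N) ^ 2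
                        - chern_class 1 (roots N) * chern_class 3 (roots N))"


section \<open>Matrices\<close>

text \<open>
  The indices \<open>1, \<dots>, 6\<close> correspond to the basis elements \<open>\<O>\<^sub>X, D\<^sub>0, D\<^sub>1, C\<^sub>0, C\<^sub>1, P\<close> in this order.
  The library's multiplication and power on vectors are componentwise, so matrix powers are
  introduced separately.
\<close>

type_synonym mat6 = "rat ^ 6 ^ 6"

primrec matpow :: "mat6 \<Rightarrow> nat \<Rightarrow> mat6" where
  "matpow A 0 = mat 1"
| "matpow A (Suc k) = A ** matpow A k"

definition L1 :: "nat \<Rightarrow> vbundle \<Rightarrow> mat6" where
  "L1 n N = vector
    [vector [1, 0, 0, 0, 0, 0],
     vector [0, 1, 0, 0, 0, 0],
     vector [1, 0, 1, 0, 0, 0],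
     vector [triple n N 0 1 1, triple n N 0 0 1, triple n N 0 1 1, 1, 0, 0],
     vector [15, triple n N 0 1 1, 15, 0, 1, 0],
     vector [0, b_number n N, 0, 0, 1, 1]]"

definition chi_mat :: "nat \<Rightarrow> vbundle \<Rightarrow> mat6" where
  "chi_mat n N = vector
    [vector [0, l_number n N, 8, 0, 0, 1],
     vector [- l_number n N, 0, b_number n N, - 1, 0, 0],
     vector [- 8, - b_number n N, 0, 0, - 1, 0],
     vector [0, 1, 0, 0, 0, 0],
     vector [0, 0, 1, 0, 0, 0],
     vector [- 1, 0, 0, 0, 0, 0]]"

definition euler_pairing :: "nat \<Rightarrow> vbundle \<Rightarrow> rat ^ 6 \<Rightarrow> rat ^ 6 \<Rightarrow> rat" where
  "euler_pairing n N u v = (\<Sum>i\<in>UNIV. u $ i * (chi_mat n N *v v) $ i)"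

definition twist :: "nat \<Rightarrow> vbundle \<Rightarrow> rat ^ 6 \<Rightarrow> mat6" where
  "twist n N e = matrix (\<lambda>v. v - euler_pairing n N e v *s e)"

definition T_O :: "nat \<Rightarrow> vbundle \<Rightarrow> mat6" where
  "T_O n N = twist n N (vector [1, 0, 0, 0, 0, 0])"

definition T_S :: "nat \<Rightarrow> vbundle \<Rightarrow> mat6" where
  "T_S n N = twist n N (vector [2, 0, - 1, - g_number N, - 6, 3])"

definition T_N :: "vbundle \<Rightarrow> mat6" where
  "T_N N = mat 1 + (\<chi> i j. if i = 4 \<and> j = 2 then - N_number N else 0)"

text \<open>The window monodromy matrix \<open>T\<^sub>N L\<^sub>1\<^sup>-\<^sup>3\<close>.\<close>

definition M0 :: "nat \<Rightarrow> vbundle \<Rightarrow> mat6" where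
  "M0 n N = T_N N ** matpow (matrix_inv (L1 n N)) 3"

end

theory Submission
  imports Defs
begin

text \<open>
  Multiplying out the cube of \<open>T\<^sub>S T\<^sub>O L\<^sub>1\<close>, with \<open>b\<close> eliminated in favour of the triple products,
  gives the identity plus the single entry \<open>3 c\<^sub>0\<^sub>0\<^sub>1 - (c\<^sub>0\<^sub>1\<^sub>1\<^sup>2 - 4 c\<^sub>0\<^sub>1\<^sub>1 g + 5 g\<^sup>2)\<close> at position
  \<open>(4, 2)\<close>; the number \<open>l\<close> drops out. Since \<open>c\<^sub>1(N) = 3 H\<close>, this entry is minus the number
  \<open>\<integral> c\<^sub>2(N)\<^sup>2 - 3 H c\<^sub>3(N)\<close> as soon as \<open>\<integral> c\<^sub>2(N)\<^sup>2 = c\<^sub>0\<^sub>1\<^sub>1\<^sup>2 - 4 c\<^sub>0\<^sub>1\<^sub>1 g + 5 g\<^sup>2\<close>. The latter holds for every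
  class of the form \<open>\<alpha> H\<^sup>2 + \<beta> x\<^sub>1 x\<^sub>2\<close>, so no classification of the bundles \<open>N\<close> is needed.
\<close>

section \<open>Chern classes\<close>

lemma chern_Nil: "chern [] = 1"
  by (simp add: chern_def)

lemma chern_Cons: "chern (r # E) = (1 + fps_const r * fps_X) * chern E"
  by (simp add: chern_def)

lemma chern_class_Nil: "chern_class k [] = (if k = 0 then 1 else 0)"
  by (simp add: chern_Nil)

lemma chern_class_Cons_0: "chern_class 0 (r # E) = chern_class 0 E"
  by (simp add: chern_Cons)

lemma chern_class_Cons_Suc: "chern_class (Suc k) (r # E) = chern_class (Suc k) E + r * chern_class k E"
  by (simp add: chern_Cons distrib_right mult.assoc)

lemma chern_class_0: "chern_class 0 E = 1"
  by (induction E) (simp_all add: chern_class_Nil chern_class_Cons_0)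

lemmas chern_class_simps = chern_class_Nil chern_class_0 chern_class_Cons_Suc

lemma chern_class_1: "chern_class 1 E = sum_list E"
  by (induction E) (simp_all add: chern_class_simps chern_class_Cons_Suc[of 0, simplified])

text \<open>Newton's identity. It trades the second Chern class for a power sum of the roots, which
  is additive over direct sums.\<close>

lemma two_chern_class_2: "2 * chern_class 2 E = chern_class 1 E ^ 2 - (\<Sum>r\<leftarrow>E. r ^ 2)"
proof (induction E)
  case (Cons r E)
  then show ?case
    by (simp add: numeral_2_eq_2 chern_class_simps algebra_simps power2_eq_square)
qed (simp add: chern_class_simps)

lemma chern_class_eq_0: "chern_class k E = 0" if "length E < k"
  using that
proof (induction E arbitrary: k)
  case (Cons r E)
  then show ?case by (cases k) (simp_all add: chern_class_Cons_Suc)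
qed (simp add: chern_class_Nil)

lemma chern_class_top: "chern_class (length E) E = prod_list E"
  by (induction E) (simp_all add: chern_class_simps chern_class_eq_0)

lemma coeff_prod_list_linear:
  "coeff (\<Prod>r\<leftarrow>E. [:r, 1:]) k = (if k \<le> length E then chern_class (length E - k) E else 0)"
proof (induction E arbitrary: k)
  case (Cons r E)
  show ?case
  proof (cases k)
    case 0
    then show ?thesis
      by (simp add: Cons.IH chern_class_Cons_Suc chern_class_eq_0)
  next
    case (Suc j)
    show ?thesis
    proof (cases "Suc j \<le> length E")
      case True
      then have "length E - j = Suc (length E - Suc j)" by simp
      with True Suc show ?thesis by (simp add: Cons.IH chern_class_Cons_Suc)
    next
      case False
      with Suc show ?thesis
        by (cases "j = length E") (simp_all add: Cons.IH chern_class_simps)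
    qed
  qed
qed (simp add: chern_class_Nil)

section \<open>Integrals over \<open>Y\<close> and \<open>X\<close>\<close>

text \<open>The class of X is the product of all L + r, so its coefficients in L are the Chern
  classes of \<open>N\<close>. Pushing forward from projective space selects one of them.\<close>

lemma int_X_L_power:
  assumes "bundle_rank N = n + 1"
  shows "int_X n N (L ^ a * pull f) = int_Y (f * chern_class (a + 1) (roots N))"
proof -
  have "chern_class (bundle_rank N) (twisted_roots N) = (\<Prod>r\<leftarrow>roots N. [:r, 1:])"
    using chern_class_top[of "twisted_roots N"]
    by (simp add: twisted_roots_def L_def pull_def)
  moreover have "L ^ a = monom 1 a"
    by (simp add: L_def monom_altdef)
  ultimately have "coeff (L ^ a * pull f * chern_class (bundle_rank N) (twisted_roots N)) n
      = f * (if n < a then 0 else coeff (\<Prod>r\<leftarrow>roots N. [:r, 1:]) (n - a))"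
    by (simp add: pull_def mult.assoc coeff_monom_mult)
  \<comment> \<open>Rank n + 1 turns the index (n + 1) - (n - a) into a + 1. For a > n both sides
    vanish, as a + 1 exceeds the rank.\<close>
  also have "\<dots> = f * chern_class (a + 1) (roots N)"
    using assms by (simp add: coeff_prod_list_linear chern_class_eq_0)
  finally show ?thesis
    by (simp add: int_X_def)
qed

section \<open>Rational coefficients and intersection numbers\<close>

definition scalar :: "rat \<Rightarrow> gr_ring" where "scalar a = [:[:a:]:]"

lemma of_nat_scalar: "of_nat k = scalar (of_nat k)"
  by (simp add: scalar_def of_nat_poly)

lemma numeral_scalar: "numeral k = scalar (numeral k)"
  by (simp add: scalar_def numeral_poly)

lemma scalar_add: "scalar (a + b) = scalar a + scalar b"
  by (simp add: scalar_def)

lemma scalar_diff: "scalar (a - b) = scalar a - scalar b"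
  by (simp add: scalar_def)

lemma scalar_mult: "scalar (a * b) = scalar a * scalar b"
  by (simp add: scalar_def)

lemma scalar_power: "scalar (a ^ k) = scalar a ^ k"
  by (simp add: scalar_def poly_const_pow)

lemma scalar_0: "scalar 0 = 0"
  by (simp add: scalar_def)

lemma scalar_1: "scalar 1 = 1"
  by (simp add: scalar_def one_pCons)

lemma int_Gr_scalar: "int_Gr (scalar a * f) = a * int_Gr f"
  by (simp add: int_Gr_def scalar_def mult.assoc)

lemma int_Gr_numeral: "int_Gr (numeral k * f) = numeral k * int_Gr f"
  by (simp add: numeral_scalar int_Gr_scalar)

lemma int_Gr_add: "int_Gr (f + g) = int_Gr f + int_Gr g"
  by (simp add: int_Gr_def distrib_right)

lemma H_eq: "H = x1 + x2"
  unfolding H_def Sdual_def chern_class_1 by simp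

text \<open>Multiplying by \<open>x1 - x2\<close> raises one exponent by one in each of two terms,
  and only x1^4 x2^3 counts. The values are not symmetric in the two roots because single monomials
  are not classes on the Grassmannian.\<close>

lemma int_Gr_monomial:
  "int_Gr (x1 ^ i * x2 ^ j) = (if i = 3 \<and> j = 3 then 1 else if i = 4 \<and> j = 2 then - 1 else 0)"
proof -
  have "x1 ^ i * x2 ^ j * (x1 - x2) = 1 * x2 ^ j * x1 ^ Suc i - 1 * x2 ^ Suc j * x1 ^ i"
    by (simp add: algebra_simps)
  then show ?thesis
    unfolding int_Gr_def
    by (simp only: coeff_diff coeff_mult_x1_power coeff_mult_x2_power) auto
qed

text \<open>The degree of Gr(2,5) in the Pluecker embedding, arising as 20 - 15.\<close>

lemma int_Gr_H6: "int_Gr (H ^ 6) = 5"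
proof -
  have "H ^ 6 = x1 ^ 6 * x2 ^ 0 + 6 * (x1 ^ 5 * x2 ^ 1) + 15 * (x1 ^ 4 * x2 ^ 2)
      + 20 * (x1 ^ 3 * x2 ^ 3) + 15 * (x1 ^ 2 * x2 ^ 4) + 6 * (x1 ^ 1 * x2 ^ 5) + x1 ^ 0 * x2 ^ 6"
    unfolding H_eq by algebra
  then show ?thesis
    by (simp only: int_Gr_add int_Gr_numeral int_Gr_monomial) simp
qed

lemma int_Gr_H4: "int_Gr (H ^ 4 * (x1 * x2)) = 2"
proof -
  have "H ^ 4 * (x1 * x2) = x1 ^ 5 * x2 ^ 1 + 4 * (x1 ^ 4 * x2 ^ 2)
      + 6 * (x1 ^ 3 * x2 ^ 3) + 4 * (x1 ^ 2 * x2 ^ 4) + x1 ^ 1 * x2 ^ 5"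
    unfolding H_eq by algebra
  then show ?thesis
    by (simp only: int_Gr_add int_Gr_numeral int_Gr_monomial) simp
qed

lemma int_Gr_H2: "int_Gr (H ^ 2 * (x1 * x2) ^ 2) = 1"
proof -
  have "H ^ 2 * (x1 * x2) ^ 2 = x1 ^ 4 * x2 ^ 2 + 2 * (x1 ^ 3 * x2 ^ 3) + x1 ^ 2 * x2 ^ 4"
    unfolding H_eq by algebra
  then show ?thesis
    by (simp only: int_Gr_add int_Gr_numeral int_Gr_monomial) simp
qed

section \<open>Symmetric classes of degree two and the second Chern class of
  \<open>N\<close>\<close>

definition quadric :: "rat \<Rightarrow> rat \<Rightarrow> gr_ring" where
  "quadric a b = scalar a * H ^ 2 + scalar b * (x1 * x2)"

lemma quadric_add: "quadric a b + quadric c d = quadric (a + c) (b + d)"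
  by (simp add: quadric_def scalar_add algebra_simps)

lemma quadric_diff: "quadric a b - quadric c d = quadric (a - c) (b - d)"
  by (simp add: quadric_def scalar_diff algebra_simps)

lemma quadric_scale: "scalar k * quadric a b = quadric (k * a) (k * b)"
  by (simp add: quadric_def scalar_mult algebra_simps)

lemma quadric_0: "0 = quadric 0 0"
  by (simp add: quadric_def scalar_0)

lemma quadric_sum: "(\<Sum>i\<in>I. quadric (f i) (g i)) = quadric (sum f I) (sum g I)"
  by (induction I rule: infinite_finite_induct) (simp_all add: quadric_0[symmetric] quadric_add)

text \<open>In the basis H^2, x1 x2 the intersection form on Y has Gram matrix ((5, 2), (2, 1)). Its
  inverse ((1, -2), (-2, 5)) expresses the self-intersection through the pairings with the two basis
  classes.\<close>

lemma int_Y_quadric_square: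
  assumes "c = quadric a b"
  shows "int_Y (c ^ 2) = int_Y (H ^ 2 * c) ^ 2 - 4 * int_Y (H ^ 2 * c) * int_Y (c * (x1 * x2))
           + 5 * int_Y (c * (x1 * x2)) ^ 2"
proof -
  have "H ^ 2 * c * H ^ 2 = scalar a * H ^ 6 + scalar b * (H ^ 4 * (x1 * x2))"
    unfolding assms quadric_def by algebra
  then have 1: "int_Y (H ^ 2 * c) = 5 * a + 2 * b"
    unfolding int_Y_def by (simp only: int_Gr_add int_Gr_scalar int_Gr_H6 int_Gr_H4)
  have "c * (x1 * x2) * H ^ 2 = scalar a * (H ^ 4 * (x1 * x2)) + scalar b * (H ^ 2 * (x1 * x2) ^ 2)"
    unfolding assms quadric_def by algebra
  then have 2: "int_Y (c * (x1 * x2)) = 2 * a + b"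
    unfolding int_Y_def by (simp only: int_Gr_add int_Gr_scalar int_Gr_H4 int_Gr_H2)
  have "c ^ 2 * H ^ 2 = scalar (a ^ 2) * H ^ 6 + scalar (2 * a * b) * (H ^ 4 * (x1 * x2))
      + scalar (b ^ 2) * (H ^ 2 * (x1 * x2) ^ 2)"
    unfolding assms quadric_def scalar_mult scalar_power numeral_scalar[symmetric] by algebra
  then have "int_Y (c ^ 2) = 5 * a ^ 2 + 4 * a * b + b ^ 2"
    unfolding int_Y_def by (simp only: int_Gr_add int_Gr_scalar int_Gr_H6 int_Gr_H4 int_Gr_H2)
  with 1 2 show ?thesis
    by (simp add: algebra_simps power2_eq_square)
qed

lemma quadric_symmetrized_square:
  "(scalar u * x1 + scalar v * x2) ^ 2 + (scalar v * x1 + scalar u * x2) ^ 2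
     = quadric (u ^ 2 + v ^ 2) (4 * u * v - 2 * (u ^ 2 + v ^ 2))"
  unfolding quadric_def H_eq scalar_add scalar_diff scalar_mult scalar_power numeral_scalar[symmetric]
  by algebra

text \<open>Exchanging x1 and x2 reverses the list of roots, so the sum of squares is
  symmetric.\<close>

lemma summand_roots_squares: "\<exists>a b. (\<Sum>r\<leftarrow>summand_roots s. r ^ 2) = quadric a b"
proof -
  obtain p q where s: "s = (p, q)" by fastforce
  \<comment> \<open>As \<open>H\<close> is x1 + x2, root number i has coefficients p + i and p + (q
    - i).\<close>
  define u :: "nat \<Rightarrow> rat" where "u i = of_nat p + of_nat i" for i
  define f where "f i = (scalar (u i) * x1 + scalar (u (q - i)) * x2) ^ 2" for i
  have "(\<Sum>r\<leftarrow>summand_roots s. r ^ 2) = (\<Sum>i\<leftarrow>[0..<Suc q]. f i)"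
    unfolding s summand_roots_def f_def u_def
    by (simp add: H_eq of_nat_scalar scalar_add algebra_simps comp_def del: upt_Suc)
  also have "\<dots> = (\<Sum>i\<le>q. f i)"
    by (simp add: interv_sum_list_conv_sum_set_nat atLeast0LessThan lessThan_Suc_atMost del: upt_Suc)
  finally have sum: "(\<Sum>r\<leftarrow>summand_roots s. r ^ 2) = (\<Sum>i\<le>q. f i)" .
  \<comment> \<open>Adding the reversed sum pairs each root with its mirror image, whatever the
    parity of q; the factor 2 is removed at the end by a rational scalar.\<close>
  have "2 * (\<Sum>i\<le>q. f i) = (\<Sum>i\<le>q. f i + f (q - i))"
    using sum.atLeastAtMost_rev[of f 0 q] by (simp add: sum.distrib atMost_atLeast0)
  also have "\<dots> = (\<Sum>i\<le>q. quadric (u i ^ 2 + u (q - i) ^ 2) (4 * u i * u (q - i) - 2 * (u i ^ 2 + u (q - i) ^ 2)))"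
    by (intro sum.cong) (simp_all add: f_def quadric_symmetrized_square)
  finally obtain a b where "2 * (\<Sum>i\<le>q. f i) = quadric a b"
    unfolding quadric_sum by blast
  then have "scalar (1 / 2 * 2) * (\<Sum>i\<le>q. f i) = quadric (1 / 2 * a) (1 / 2 * b)"
    unfolding scalar_mult mult.assoc numeral_scalar[symmetric] by (simp only: quadric_scale)
  then show ?thesis
    by (auto simp: sum scalar_1)
qed

lemma roots_squares: "\<exists>a b. (\<Sum>r\<leftarrow>roots N. r ^ 2) = quadric a b"
proof (induction N)
  case Nil
  show ?case using quadric_0 by (simp add: roots_def) metis
next
  case (Cons s N)
  then obtain a b where "(\<Sum>r\<leftarrow>roots N. r ^ 2) = quadric a b" by blast
  moreover obtain c d where "(\<Sum>r\<leftarrow>summand_roots s. r ^ 2) = quadric c d"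
    using summand_roots_squares by blast
  ultimately have "(\<Sum>r\<leftarrow>roots (s # N). r ^ 2) = quadric (c + a) (d + b)"
    by (simp add: roots_def quadric_add)
  then show ?case by blast
qed

lemma chern_class_2_quadric:
  assumes "chern_class 1 (roots N) = 3 * H"
  shows "\<exists>a b. chern_class 2 (roots N) = quadric a b"
proof -
  obtain a b where ab: "(\<Sum>r\<leftarrow>roots N. r ^ 2) = quadric a b"
    using roots_squares by blast
  have "(3 * H) ^ 2 = quadric 9 0"
    by (simp add: quadric_def numeral_scalar[symmetric] power_mult_distrib scalar_0)
  then have "2 * chern_class 2 (roots N) = quadric (9 - a) (0 - b)"
    unfolding two_chern_class_2 assms ab by (simp only: quadric_diff)
  then have "scalar (1 / 2 * 2) * chern_class 2 (roots N) = quadric (1 / 2 * (9 - a)) (1 / 2 * (0 - b))"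
    unfolding scalar_mult mult.assoc numeral_scalar[symmetric] by (simp only: quadric_scale)
  then show ?thesis
    by (auto simp: scalar_1)
qed

text \<open>Both c and g are pairings of the second Chern class of \<open>N\<close>, with H^2 and x1
  x2, so they determine its square.\<close>

lemma N_number_eq:
  assumes "splitting_configuration n N"
  defines "c \<equiv> triple n N 0 1 1" and "g \<equiv> g_number N"
  shows "N_number N = c ^ 2 - 4 * c * g + 5 * g ^ 2 - 3 * triple n N 0 0 1"
proof -
  have rank: "bundle_rank N = n + 1" and c1: "chern_class 1 (roots N) = 3 * H"
    using assms(1) by (simp_all add: splitting_configuration_def)
  have int_Y_diff: "int_Y (f - scalar k * h) = int_Y f - k * int_Y h" for f h k
    using int_Gr_add[of "(f - scalar k * h) * H ^ 2" "scalar k * (h * H ^ 2)"]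
    unfolding int_Y_def int_Gr_scalar by (simp add: algebra_simps)
  have "chern_class 2 Sdual = x1 * x2"
    using chern_class_top[of Sdual] by (simp add: Sdual_def numeral_2_eq_2)
  then have g: "g = int_Y (chern_class 2 (roots N) * (x1 * x2))"
    by (simp add: g_def g_number_def)
  have c: "c = int_Y (H ^ 2 * chern_class 2 (roots N))"
    using int_X_L_power[OF rank, of 1 "H ^ 2", unfolded one_add_one]
    by (simp add: c_def triple_def divisor_def pull_def power2_eq_square)
  have "triple n N 0 0 1 = int_Y (H * chern_class 3 (roots N))"
    using int_X_L_power[OF rank, of 2 H]
    by (simp add: triple_def divisor_def power2_eq_square)
  moreover have "N_number N = int_Y (chern_class 2 (roots N) ^ 2) - 3 * int_Y (H * chern_class 3 (roots N))"
    unfolding N_number_def c1 mult.assoc numeral_scalar int_Y_diff ..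
  moreover obtain a b where "chern_class 2 (roots N) = quadric a b"
    using chern_class_2_quadric[OF c1] by blast
  ultimately show ?thesis
    using int_Y_quadric_square unfolding c g by simp
qed

section \<open>Matrices\<close>

lemma exhaust_6:
  fixes x :: 6
  shows "x = 1 \<or> x = 2 \<or> x = 3 \<or> x = 4 \<or> x = 5 \<or> x = 6"
proof (induct x)
  case (of_int z)
  \<comment> \<open>In the type \<open>6\<close> the numeral 6 equals 0, so the representative 0
    yields the last case.\<close>
  then have "z = 0 \<or> z = 1 \<or> z = 2 \<or> z = 3 \<or> z = 4 \<or> z = 5" by fastforce
  then show ?case by auto
qed

lemma forall_6: "(\<forall>i::6. P i) \<longleftrightarrow> P 1 \<and> P 2 \<and> P 3 \<and> P 4 \<and> P 5 \<and> P 6"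
  by (metis exhaust_6)

lemma UNIV_6: "UNIV = {1, 2, 3, 4, 5, 6::6}"
  using exhaust_6 by auto

lemma sum_6: "sum f (UNIV::6 set) = f 1 + f 2 + f 3 + f 4 + f 5 + f 6"
  unfolding UNIV_6 by (simp add: ac_simps)

lemma vector_6 [simp]:
  "(vector [a,b,c,d,e,f] :: 'a::zero^6) $ 1 = a"
  "(vector [a,b,c,d,e,f] :: 'a::zero^6) $ 2 = b"
  "(vector [a,b,c,d,e,f] :: 'a::zero^6) $ 3 = c"
  "(vector [a,b,c,d,e,f] :: 'a::zero^6) $ 4 = d"
  "(vector [a,b,c,d,e,f] :: 'a::zero^6) $ 5 = e"
  "(vector [a,b,c,d,e,f] :: 'a::zero^6) $ 6 = f"
  unfolding vector_def by simp_all

lemmas mat6_simps = vec_eq_iff forall_6 matrix_matrix_mult_def sum_6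

section \<open>Explicit matrices of the twists and of the cube\<close>

lemma twist_entry:
  "twist n N e $ i $ j = (if i = j then 1 else 0) - (\<Sum>k\<in>UNIV. e $ k * chi_mat n N $ k $ j) * e $ i"
  by (simp add: twist_def matrix_def euler_pairing_def matrix_vector_mult_def axis_def if_distrib cong: if_cong)

lemma T_O_eq:
  "T_O n N = (let l = l_number n N in vector
    [vector [1, - l, - 8, 0, 0, - 1],
     vector [0, 1, 0, 0, 0, 0],
     vector [0, 0, 1, 0, 0, 0],
     vector [0, 0, 0, 1, 0, 0],
     vector [0, 0, 0, 0, 1, 0],
     vector [0, 0, 0, 0, 0, 1]])"
  unfolding T_O_def Let_def
  by (simp add: vec_eq_iff forall_6 twist_entry sum_6 chi_mat_def)

lemma T_S_eq:
  "T_S n N = (let l = l_number n N; b = b_number n N; g = g_number N in vector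
    [vector [- 9, - 2 * b + 2 * g - 4 * l, - 20, 0, - 2, - 4],
     vector [0, 1, 0, 0, 0, 0],
     vector [5, b - g + 2 * l, 11, 0, 1, 2],
     vector [5 * g, b * g - g^2 + 2 * g * l, 10 * g, 1, g, 2 * g],
     vector [30, 6 * b - 6 * g + 12 * l, 60, 0, 7, 12],
     vector [- 15, - 3 * b + 3 * g - 6 * l, - 30, 0, - 3, - 5]])"
  unfolding T_S_def Let_def
  by (simp add: vec_eq_iff forall_6 twist_entry sum_6 chi_mat_def algebra_simps power2_eq_square)

lemma T_S_T_O_L1_eq:
  "T_S n N ** T_O n N ** L1 n N =
    (let c = triple n N 0 1 1; l = l_number n N; b = b_number n N; g = g_number N in vector
    [vector [13, - 2 * c + 3 * b + 2 * g + 5 * l, 22, 0, 3, 5],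
     vector [0, 1, 0, 0, 0, 0],
     vector [- 9, c - 2 * b - g - 3 * l, - 14, 0, - 2, - 3],
     vector [c - 10 * g, c * g + c - 2 * b * g - 2 * b - g^2 - 3 * g * l, c - 15 * g, 1, - 2 * g, - 3 * g],
     vector [- 45, 7 * c - 12 * b - 6 * g - 18 * l, - 75, 0, - 11, - 18],
     vector [30, - 3 * c + 7 * b + 3 * g + 9 * l, 45, 0, 7, 10]])"
proof -
  \<comment> \<open>Replacing c_001 by c - 2b makes all entries polynomials in c, l, b and
    g.\<close>
  have "triple n N 0 0 1 = triple n N 0 1 1 - 2 * b_number n N"
    by (simp add: b_number_def diff_divide_distrib)
  then show ?thesis
    unfolding T_O_eq T_S_eq L1_def Let_def
    by (simp add: mat6_simps algebra_simps power2_eq_square)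
qed

lemma T_S_T_O_L1_square_eq:
  "(T_S n N ** T_O n N ** L1 n N) ** (T_S n N ** T_O n N ** L1 n N) =
    (let c = triple n N 0 1 1; l = l_number n N; b = b_number n N; g = g_number N in vector
    [vector [- 14, - 3 * b + 3 * g - 5 * l, - 22, 0, - 3, - 5],
     vector [0, 1, 0, 0, 0, 0],
     vector [9, 2 * b - 2 * g + 3 * l, 13, 0, 2, 3],
     vector [5 * c - 5 * g, c * b - c^2 + 3 * c * g + 2 * c * l + 2 * c - b * g - 4 * b - 4 * g^2 - 2 * g * l,
       9 * c - 10 * g, 1, c - g, 2 * c - 2 * g],
     vector [45, - c + 9 * b - 9 * g + 18 * l, 75, 0, 10, 18],
     vector [- 30, c - 7 * b + 6 * g - 12 * l, - 45, 0, - 7, - 11]])"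
  unfolding T_S_T_O_L1_eq Let_def
  by (simp add: mat6_simps algebra_simps power2_eq_square)

lemma T_S_T_O_L1_cube_eq:
  fixes n N
  defines "c \<equiv> triple n N 0 1 1" and "g \<equiv> g_number N"
  shows "matpow (T_S n N ** T_O n N ** L1 n N) 3 =
    mat 1 + (\<chi> i j. if i = 4 \<and> j = 2 then 3 * triple n N 0 0 1 - (c^2 - 4 * c * g + 5 * g^2) else 0)"
proof -
  have "triple n N 0 0 1 = c - 2 * b_number n N"
    by (simp add: b_number_def c_def diff_divide_distrib)
  moreover have "matpow A 3 = (A ** A) ** A" for A
    by (simp add: eval_nat_numeral matrix_mul_assoc)
  ultimately show ?thesis
    \<comment> \<open>The square is rewritten first, while its pattern is still intact.\<close>
    unfolding T_S_T_O_L1_square_eq unfolding T_S_T_O_L1_eq Let_def c_def g_def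
    by (simp add: mat6_simps mat_def algebra_simps power2_eq_square)
qed

text \<open>\<open>T_N\<close> differs from 1 by a multiple of the matrix unit E at (4, 2). E a
  copies row 2 of a into row 4, and a E copies column 4 into column 2; here both equal E.\<close>

lemma T_N_commute:
  assumes "\<And>j. a $ 2 $ j = (if j = 2 then 1 else 0)" "\<And>i. a $ i $ 4 = (if i = 4 then 1 else 0)"
  shows "T_N N ** a = a ** T_N N"
  using assms by (simp add: T_N_def mat6_simps mat_def)

lemma T_N_left_inverse:
  "(mat 1 + (\<chi> i j. if i = 4 \<and> j = 2 then N_number N else 0)) ** T_N N = mat 1"
  by (simp add: T_N_def mat6_simps mat_def)

lemma matpow_left_inverse:
  assumes "B ** A = mat 1"
  shows "matpow B k ** matpow A k = mat 1"
proof (induction k)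
  case (Suc k)
  \<comment> \<open>\<open>matpow\<close> adds factors on the left; moving one to the right brings B
    next to A.\<close>
  have comm: "matpow B k ** B = B ** matpow B k" for k
    by (induction k) (simp_all add: matrix_mul_assoc[symmetric])
  have "matpow B (Suc k) ** matpow A (Suc k) = matpow B k ** (B ** A) ** matpow A k"
    by (simp add: comm[symmetric] matrix_mul_assoc)
  then show ?case
    using assms Suc by simp
qed simp

theorem proposition5p2:
  fixes n :: nat and N :: vbundle
  assumes "splitting_configuration n N"
  shows "(\<forall>a \<in> {L1 n N, T_O n N, T_S n N}.
            matpow (T_S n N ** T_O n N ** L1 n N) 3 ** a
              = a ** matpow (T_S n N ** T_O n N ** L1 n N) 3)
         \<and> M0 n N ** matpow (L1 n N) 3 = matpow (T_S n N ** T_O n N ** L1 n N) 3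
         \<and> matpow (T_S n N ** T_O n N ** L1 n N) 3 = T_N N"
proof -
  define A where "A = T_S n N ** T_O n N ** L1 n N"
  have cube: "matpow A 3 = T_N N"
    unfolding A_def T_S_T_O_L1_cube_eq T_N_def N_number_eq[OF assms] by (simp only: minus_diff_eq)
  have "T_N N ** a = a ** T_N N" if "a \<in> {L1 n N, T_O n N, T_S n N}" for a
  \<comment> \<open>For the twists both conditions hold because e has no D_0 component, which also
    gives chi(e, C_0) = 0.\<close>
  proof (rule T_N_commute)
    show "a $ 2 $ j = (if j = 2 then 1 else 0)" for j
      using that exhaust_6[of j] by (auto simp: L1_def T_O_eq T_S_eq Let_def)
    show "a $ i $ 4 = (if i = 4 then 1 else 0)" for i
      using that exhaust_6[of i] by (auto simp: L1_def T_O_eq T_S_eq Let_def)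
  qed
  moreover have "M0 n N ** matpow (L1 n N) 3 = T_N N"
  proof -
    \<comment> \<open>Invertibility of \<open>L1\<close> is read off from the cube:
      \<open>T_N\<close> is unipotent with inverse ?U and has \<open>L1\<close> as its rightmost
      factor.\<close>
    let ?U = "mat 1 + (\<chi> i j. if i = 4 \<and> j = 2 then N_number N else 0) :: mat6"
    have "T_N N = A ** A ** T_S n N ** T_O n N ** L1 n N"
      unfolding cube[symmetric] by (simp add: A_def eval_nat_numeral matrix_mul_assoc)
    then have "(?U ** (A ** A ** T_S n N ** T_O n N)) ** L1 n N = mat 1"
      using T_N_left_inverse[of N] by (simp only: matrix_mul_assoc)
    then have "invertible (L1 n N)"
      using invertible_left_inverse by blast
    then have "matrix_inv (L1 n N) ** L1 n N = mat 1"
      unfolding invertible_def matrix_inv_def by (rule someI2_ex) simp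
    then have "matpow (matrix_inv (L1 n N)) 3 ** matpow (L1 n N) 3 = mat 1"
      by (rule matpow_left_inverse)
    then show ?thesis
      by (simp add: M0_def matrix_mul_assoc[symmetric])
  qed
  ultimately show ?thesis
    unfolding A_def[symmetric] cube by blast
qed

end
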